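(* The Lie algebra of vector fields generated by $\mathbf{G}^{0,1},\mathbf{G}^{0,2},\mathbf{G}^{1,1}$ is $$\operatorname{Lie}\left(\left\{\mathbf{G}^{0,1},\mathbf{G}^{0,2},\mathbf{G}^{1,1}\right\}\right)=\mathrm{Span}\left\{\mathcal{H}_{\mathbf{g}^*_1,k},\ \mathcal{H}_{\mathbf{g}^*_2,k},\ \mathcal{H}_{\mathbf{g}^*_3,k}: k\in\mathbb{N}_0\right\}.$$
   Context: Elements of $\prod_{i=0}^\infty\mathbb{R}^3$ are written $\mathfrak{m}=(\mathbf{m}_0,\mathbf{m}_1,\mathbf{m}_2,\dots)$ with $\mathbf{m}_i\in\mathbb{R}^3$. For $\mathbf{x}=(x_1,x_2,x_3)^\top\in\mathbb{R}^3$ let $\mathbf{g}^*_1(\mathbf{x})=(0,x_3,-x_2)^\top$, $\mathbf{g}^*_2(\mathbf{x})=(-x_3,0,x_1)^\top$, $\mathbf{g}^*_3(\mathbf{x})=(x_2,-x_1,0)^\top$. The vector fields $\mathbf{G}^{0,l}$ and $\mathbf{G}^{1,l}$ on $\prod_{i=0}^\infty\mathbb{R}^3$ have components $$[\mathbf{G}^{0,l}(\mathfrak{m})]_i=\tfrac{1}{\sqrt2}\mathbf{g}^*_l(\mathbf{m}_i)\ (i\ge0),\qquad [\mathbf{G}^{1,l}(\mathfrak{m})]_0=\tfrac1{\sqrt2}\mathbf{g}^*_l(\mathbf{m}_1),\qquad [\mathbf{G}^{1,l}(\mathfrak{m})]_i=\tfrac1{\sqrt2}\mathbf{g}^*_l(\mathbf{m}_{i-1})+\tfrac1{\sqrt2}\mathbf{g}^*_l(\mathbf{m}_{i+1})\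 (i\ge1).$$ For $N\in\mathbb{N}_0$ and $l\in\{1,2,3\}$, $\mathcal{H}_{\mathbf{g}^*_l,N}$ is the vector field with components $$[\mathcal{H}_{\mathbf{g}^*_l,N}(\mathfrak{m})]_i=\sum_{\substack{j\ge0\\ j\equiv i+N\ (\mathrm{mod}\ 2)}}\left(\binom{N}{\frac{N+j-i}{2}}-\binom{N}{\frac{N+i+j}{2}+1}\right)\mathbf{g}^*_l(\mathbf{m}_j),\qquad i\ge0,$$ with $\binom{N}{r}=0$ for $r<0$ or $r>N$ (the sum is finite). The Lie bracket of vector fields $f,g$ is $[f,g]=Df\,g-Dg\,f$, and $\operatorname{Lie}(\mathcal{F})$ is the real linear span of the fields in $\mathcal{F}$ and all their iterated Lie brackets; $\mathrm{Span}$ denotes finite real linear combinations. *)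

theory Defs
  imports "HOL-Analysis.Analysis" "HOL-Library.Function_Algebras" "HOL-Number_Theory.Cong"
begin

text \<open>The pointwise real vector space structure on function spaces, which makes \<open>span\<close>
  available both for sequences and for vector fields.\<close>

instantiation "fun" :: (type, real_vector) real_vector
begin

definition scaleR_fun :: "real \<Rightarrow> ('a \<Rightarrow> 'b) \<Rightarrow> 'a \<Rightarrow> 'b"
  where "scaleR_fun c f = (\<lambda>x. c *\<^sub>R f x)"

instance
  by standard (simp_all add: scaleR_fun_def fun_eq_iff scaleR_add_right scaleR_add_left)

end

text \<open>The limit is taken in the topology of \<open>'a\<close>. For sequence spaces such as
  \<open>nat \<Rightarrow> real^3\<close> this is the product topology. When the limit does not exist the value is
  unspecified; all vector fields considered below are linear and continuous.\<close>

definition dir_deriv :: "('a \<Rightarrow> 'a) \<Rightarrow> 'a \<Rightarrow> 'a \<Rightarrow> 'a::{real_vector, t2_space}"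
  where "dir_deriv f m v = Lim (at (0::real)) (\<lambda>t. (f (m + t *\<^sub>R v) - f m) /\<^sub>R t)"

definition lie_bracket :: "('a \<Rightarrow> 'a) \<Rightarrow> ('a \<Rightarrow> 'a) \<Rightarrow> 'a \<Rightarrow> 'a::{real_vector, t2_space}"
  where "lie_bracket f g = (\<lambda>m. dir_deriv f m (g m) - dir_deriv g m (f m))"

inductive_set iterated_brackets :: "('a \<Rightarrow> 'a::{real_vector, t2_space}) set \<Rightarrow> ('a \<Rightarrow> 'a) set"
  for F where
    generator: "f \<in> F \<Longrightarrow> f \<in> iterated_brackets F"
  | bracket: "\<lbrakk>f \<in> iterated_brackets F; g \<in> iterated_brackets F\<rbrakk>
      \<Longrightarrow> lie_bracket f g \<in> iterated_brackets F"

definition Lie :: "('a \<Rightarrow> 'a::{real_vector, t2_space}) set \<Rightarrow> ('a \<Rightarrow> 'a) set"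
  where "Lie F = span (iterated_brackets F)"

definition gstar1 :: "real^3 \<Rightarrow> real^3"
  where "gstar1 x = vector [0, x$3, - x$2]"

definition gstar2 :: "real^3 \<Rightarrow> real^3"
  where "gstar2 x = vector [- x$3, 0, x$1]"

definition gstar3 :: "real^3 \<Rightarrow> real^3"
  where "gstar3 x = vector [x$2, - x$1, 0]"

definition G0 :: "(real^3 \<Rightarrow> real^3) \<Rightarrow> (nat \<Rightarrow> real^3) \<Rightarrow> nat \<Rightarrow> real^3"
  where "G0 g m = (\<lambda>i. (1 / sqrt 2) *\<^sub>R g (m i))"

definition G1 :: "(real^3 \<Rightarrow> real^3) \<Rightarrow> (nat \<Rightarrow> real^3) \<Rightarrow> nat \<Rightarrow> real^3"
  where "G1 g m = (\<lambda>i. if i = 0 then (1 / sqrt 2) *\<^sub>R g (m 1)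
    else (1 / sqrt 2) *\<^sub>R g (m (i - 1)) + (1 / sqrt 2) *\<^sub>R g (m (i + 1)))"

text \<open>Binomial coefficient with an integer lower index, zero outside \<open>0..N\<close>.\<close>

definition zchoose :: "nat \<Rightarrow> int \<Rightarrow> nat"
  where "zchoose N r = (if r < 0 then 0 else N choose nat r)"

text \<open>The coefficient below vanishes for \<open>j > i + N\<close>, so the \<open>infsum\<close> has only finitely many
  nonzero terms; on the index set of the sum both integer divisions by 2 are exact.\<close>

definition hfield :: "(real^3 \<Rightarrow> real^3) \<Rightarrow> nat \<Rightarrow> (nat \<Rightarrow> real^3) \<Rightarrow> nat \<Rightarrow> real^3"
  where "hfield g N m = (\<lambda>i. \<Sum>\<^sub>\<infinity>j\<in>{j. [j = i + N] (mod 2)}.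
    (real (zchoose N ((int N + int j - int i) div 2))
      - real (zchoose N ((int N + int i + int j) div 2 + 1))) *\<^sub>R g (m j))"

end

theory Submission
  imports Defs
begin

text \<open>By the reflection principle the coefficients of \<open>\<H>\<close> count paths on the half line, so
  \<open>\<H>\<^bsub>g,N\<^esub>(m) = T\<^sup>N (g \<circ> m)\<close> where \<open>T\<close> is the nearest-neighbour sum on sequences. As \<open>T\<close>
  commutes with the componentwise action of a linear \<open>g\<close>, the bracket of \<open>\<H>\<^bsub>g,k\<^esub>\<close> and
  \<open>\<H>\<^bsub>h,l\<^esub>\<close> is \<open>\<H>\<^bsub>[g,h],k+l\<^esub>\<close>, and everything reduces to the commutation relations of
  so(3).\<close>

subsection \<open>Lie brackets of linear vector fields\<close>

lemma dir_deriv_linear: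
  fixes f :: "'a::{real_vector, t2_space} \<Rightarrow> 'a"
  assumes "linear f"
  shows "dir_deriv f m v = f v"
proof -
  have "((\<lambda>t. (f (m + t *\<^sub>R v) - f m) /\<^sub>R t) \<longlongrightarrow> f v) (at (0::real))"
    by (rule tendsto_eventually)
      (auto simp: eventually_at_filter linear_add[OF assms] linear_scale[OF assms])
  then show ?thesis
    unfolding dir_deriv_def by (intro tendsto_Lim) simp_all
qed

lemma lie_bracket_linear:
  assumes "linear f" "linear g"
  shows "lie_bracket f g = (\<lambda>m. f (g m) - g (f m))"
  by (simp add: lie_bracket_def dir_deriv_linear assms)

lemma linear_fun_add:
  fixes f g :: "'a::real_vector \<Rightarrow> 'b::real_vector"
  assumes "linear f" "linear g"
  shows "linear (f + g)"
  using linear_compose_add[OF assms] by (simp add: plus_fun_def)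

lemma scaleR_fun_apply: "(c *\<^sub>R f) x = c *\<^sub>R f x"
  by (simp add: scaleR_fun_def)

lemma linear_fun_scaleR:
  fixes f :: "'a::real_vector \<Rightarrow> 'b::real_vector"
  assumes "linear f"
  shows "linear (c *\<^sub>R f)"
  using linear_compose_scale_right[OF assms, of c] by (simp add: scaleR_fun_def)

lemma linear_fun_zero: "linear (0 :: 'a::real_vector \<Rightarrow> 'b::real_vector)"
  using linear_zero by (simp add: zero_fun_def)

lemma linear_span:
  fixes S :: "('a::real_vector \<Rightarrow> 'b::real_vector) set"
  assumes "\<And>f. f \<in> S \<Longrightarrow> linear f" "f \<in> span S"
  shows "linear f"
  using assms(2)
proof (induction rule: span_induct_alt)
  case base
  show ?case by (rule linear_fun_zero)
next
  case (step c x y)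
  then show ?case by (simp only: linear_fun_add linear_fun_scaleR assms(1))
qed

lemma linear_lie_bracket:
  assumes "linear f" "linear g"
  shows "linear (lie_bracket f g)"
  using linear_compose_sub[OF linear_compose[OF assms(2,1)] linear_compose[OF assms]]
  by (simp add: lie_bracket_linear assms o_def)

lemma lie_bracket_add_scaleR_left:
  assumes "linear f" "linear f'" "linear g"
  shows "lie_bracket (c *\<^sub>R f + f') g = c *\<^sub>R lie_bracket f g + lie_bracket f' g"
  by (simp add: lie_bracket_linear assms linear_fun_add linear_fun_scaleR fun_eq_iff
      scaleR_fun_apply linear_add[OF assms(3)] linear_scale[OF assms(3)] scaleR_diff_right)

lemma lie_bracket_minus_swap:
  assumes "linear f" "linear g"
  shows "lie_bracket f g = - lie_bracket g f"
  by (simp add: lie_bracket_linear assms fun_eq_iff)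

lemma lie_bracket_span_left:
  assumes lin: "\<And>f. f \<in> S \<Longrightarrow> linear f" and "linear g"
    and closed: "\<And>f. f \<in> S \<Longrightarrow> lie_bracket f g \<in> span T"
    and "f \<in> span S"
  shows "lie_bracket f g \<in> span T"
proof -
  have "linear f \<and> lie_bracket f g \<in> span T"
    using assms(4)
  proof (induction rule: span_induct_alt)
    case base
    have "lie_bracket 0 g = 0"
      using assms(2) by (simp add: lie_bracket_linear linear_fun_zero fun_eq_iff linear_0)
    then show ?case by (simp only: span_zero linear_fun_zero)
  next
    case (step c x y)
    then show ?case
      using assms(2) lin[OF step(1)] closed[OF step(1)]
      by (simp only: lie_bracket_add_scaleR_left span_add span_scale
          linear_fun_add linear_fun_scaleR)
  qed
  then show ?thesis ..
qed

lemma lie_bracket_span: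
  assumes lin: "\<And>f. f \<in> S \<Longrightarrow> linear f"
    and closed: "\<And>f g. f \<in> S \<Longrightarrow> g \<in> S \<Longrightarrow> lie_bracket f g \<in> span S"
    and f: "f \<in> span S" and g: "g \<in> span S"
  shows "lie_bracket f g \<in> span S"
proof (rule lie_bracket_span_left[OF lin _ _ f])
  show "linear g" by (rule linear_span[OF lin g])
next
  fix f' assume f': "f' \<in> S"
  have "lie_bracket g f' \<in> span S"
    by (rule lie_bracket_span_left[OF lin lin[OF f'] _ g]) (use f' closed in auto)
  then show "lie_bracket f' g \<in> span S"
    by (metis lie_bracket_minus_swap[OF lin[OF f'] linear_span[OF lin g]] span_neg)
qed

lemma linear_iterated_brackets:
  assumes "\<And>f. f \<in> F \<Longrightarrow> linear f" "f \<in> iterated_brackets F"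
  shows "linear f"
  using assms(2) by induction (auto intro: linear_lie_bracket assms(1))

lemma lie_bracket_in_Lie:
  assumes "\<And>f. f \<in> F \<Longrightarrow> linear f" "f \<in> Lie F" "g \<in> Lie F"
  shows "lie_bracket f g \<in> Lie F"
  using assms(2,3) unfolding Lie_def
proof (rule lie_bracket_span[rotated 2])
  fix f assume "f \<in> iterated_brackets F"
  with assms(1) show "linear f" by (rule linear_iterated_brackets)
qed (intro span_base iterated_brackets.bracket)

lemma Lie_subset_span:
  assumes lin: "\<And>f. f \<in> S \<Longrightarrow> linear f" and "F \<subseteq> span S"
    and closed: "\<And>f g. f \<in> S \<Longrightarrow> g \<in> S \<Longrightarrow> lie_bracket f g \<in> span S"
  shows "Lie F \<subseteq> span S"
proof -
  have "f \<in> span S" if "f \<in> iterated_brackets F" for f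
    using that
  proof induction
    case (generator f)
    then show ?case using assms(2) by blast
  next
    case (bracket f g)
    show ?case by (rule lie_bracket_span[OF lin closed bracket.IH])
  qed
  then show ?thesis
    unfolding Lie_def by (intro span_minimal) auto
qed

subsection \<open>The fields as powers of the nearest-neighbour sum\<close>

definition nbsum :: "(nat \<Rightarrow> 'a::real_vector) \<Rightarrow> nat \<Rightarrow> 'a"
  where "nbsum m = (\<lambda>i. case i of 0 \<Rightarrow> m 1 | Suc i' \<Rightarrow> m i' + m (Suc i))"

definition hcoeff :: "nat \<Rightarrow> int \<Rightarrow> int \<Rightarrow> real"
  where "hcoeff N i j = real (zchoose N ((int N + j - i) div 2))
    - real (zchoose N ((int N + i + j) div 2 + 1))"

lemma zchoose_eq_0: "r > int N \<Longrightarrow> zchoose N r = 0"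
  by (auto simp: zchoose_def)

lemma zchoose_Suc: "zchoose (Suc N) r = zchoose N r + zchoose N (r - 1)"
proof (cases "r \<le> 0")
  case True
  then show ?thesis by (cases "r = 0") (auto simp: zchoose_def)
next
  case False
  then obtain k where "r = int (Suc k)" by (metis not_le zero_less_imp_eq_int Suc_pred)
  then show ?thesis by (simp add: zchoose_def nat_add_distrib)
qed

lemma hcoeff_Suc:
  assumes "even (int (Suc N) + i + j)"
  shows "hcoeff (Suc N) i j = hcoeff N (i - 1) j + hcoeff N (i + 1) j"
proof -
  obtain a where a: "int (Suc N) + i + j = 2 * a" using assms by blast
  define b where "b = a - i"
  have half: "(int (Suc N) + j - i) div 2 = b" "(int (Suc N) + i + j) div 2 = a"
    "(int N + j - (i - 1)) div 2 = b" "(int N + j - (i + 1)) div 2 = b - 1"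
    "(int N + (i - 1) + j) div 2 = a - 1" "(int N + (i + 1) + j) div 2 = a"
    using a by (auto simp: b_def)
  show ?thesis
    unfolding hcoeff_def by (simp only: half zchoose_Suc) simp
qed

lemma hcoeff_boundary: "hcoeff N (- 1) j = 0"
proof -
  have "(int N + j + 1) div 2 = (int N - 1 + j) div 2 + 1"
    by presburger
  then show ?thesis by (simp add: hcoeff_def)
qed

lemma hcoeff_eq_0: "i + int N < j \<Longrightarrow> 0 \<le> i \<Longrightarrow> even (i + j + int N) \<Longrightarrow> hcoeff N i j = 0"
  unfolding hcoeff_def by (subst (1 2) zchoose_eq_0) (presburger | simp)+

lemma hcoeff_0:
  assumes "0 \<le> i" "0 \<le> j" "even (i + j)"
  shows "hcoeff 0 i j = (if i = j then 1 else 0)"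
proof -
  have "(j - i) div 2 = 0 \<longleftrightarrow> i = j" "(i + j) div 2 + 1 > 0"
    using assms by presburger+
  then show ?thesis by (auto simp: hcoeff_def zchoose_def binomial_eq_0)
qed

lemma hfield_sum:
  assumes "i + N \<le> B"
  shows "hfield g N m i = (\<Sum>j\<in>{j. j \<le> B \<and> even (i + N + j)}. hcoeff N i j *\<^sub>R g (m j))"
proof -
  have "hfield g N m i = (\<Sum>\<^sub>\<infinity>j\<in>{j. j \<le> B \<and> even (i + N + j)}. hcoeff N i j *\<^sub>R g (m j))"
    unfolding hfield_def hcoeff_def[symmetric]
  proof (rule infsum_cong_neutral)
    fix j assume "j \<in> {j. [j = i + N] (mod 2)} - {j. j \<le> B \<and> even (i + N + j)}"
    then have "B < j" "even (i + j + N)"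
      by (auto simp: cong_def) presburger+
    then have "hcoeff N (int i) (int j) = 0"
      using assms by (intro hcoeff_eq_0) (auto simp flip: of_nat_add)
    then show "hcoeff N (int i) (int j) *\<^sub>R g (m j) = 0" by simp
  qed (auto simp: cong_def, presburger+)
  then show ?thesis by simp
qed

lemma hfield_0: "hfield g 0 m = g \<circ> m"
proof
  fix i
  have "hfield g 0 m i
    = (\<Sum>j\<in>{j. j \<le> i \<and> even (i + j)}. (if i = j then 1 else 0) *\<^sub>R g (m j))"
    unfolding hfield_sum[of i 0 i, simplified]
    by (intro sum.cong refl) (auto simp: hcoeff_0 simp flip: of_nat_add)
  also have "\<dots> = (\<Sum>j\<in>{j. j \<le> i \<and> even (i + j)}. if i = j then g (m j) else 0)"
    by (intro sum.cong) auto
  also have "\<dots> = g (m i)"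
    by (subst sum.delta') auto
  finally show "hfield g 0 m i = (g \<circ> m) i" by simp
qed

lemma hfield_Suc: "hfield g (Suc N) m = nbsum (hfield g N m)"
proof
  fix i
  define B where "B = i + Suc N"
  define J where "J = {j. j \<le> B \<and> even (Suc (i + N + j))}"
  have "hfield g (Suc N) m i = (\<Sum>j\<in>J. hcoeff (Suc N) i j *\<^sub>R g (m j))"
    by (subst hfield_sum[of _ _ B]) (auto simp: J_def B_def)
  also have "\<dots> = (\<Sum>j\<in>J. hcoeff N (int i - 1) j *\<^sub>R g (m j) + hcoeff N (int i + 1) j *\<^sub>R g (m j))"
  proof (intro sum.cong refl)
    fix j assume "j \<in> J"
    then have "even (int (Suc N) + int i + int j)"
      unfolding J_def by (simp flip: of_nat_add) presburger
    then show "hcoeff (Suc N) i j *\<^sub>R g (m j)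
      = hcoeff N (int i - 1) j *\<^sub>R g (m j) + hcoeff N (int i + 1) j *\<^sub>R g (m j)"
      by (simp add: hcoeff_Suc scaleR_add_left)
  qed
  also have "\<dots> = (\<Sum>j\<in>J. hcoeff N (int i - 1) j *\<^sub>R g (m j)) + hfield g N m (Suc i)"
    by (subst hfield_sum[of "Suc i" _ B]) (auto simp: J_def B_def sum.distrib add.commute)
  also have "\<dots> = nbsum (hfield g N m) i"
  proof (cases i)
    case 0
    then show ?thesis by (simp add: nbsum_def hcoeff_boundary)
  next
    case (Suc i')
    have "(\<Sum>j\<in>J. hcoeff N (int i - 1) j *\<^sub>R g (m j)) = hfield g N m i'"
      by (subst hfield_sum[of i' _ B]) (auto simp: J_def B_def Suc)
    then show ?thesis by (simp add: nbsum_def Suc)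
  qed
  finally show "hfield g (Suc N) m i = nbsum (hfield g N m) i" .
qed

lemma hfield_eq_nbsum: "hfield g N m = (nbsum ^^ N) (g \<circ> m)"
  by (induction N) (simp_all add: hfield_0 hfield_Suc)

lemma linear_nbsum: "linear nbsum"
  by (rule linearI)
    (auto simp: nbsum_def fun_eq_iff scaleR_fun_def scaleR_add_right split: nat.split)

lemma linear_nbsum_power: "linear (nbsum ^^ N)"
proof (induction N)
  case 0
  show ?case by (simp only: funpow.simps linear_id)
next
  case (Suc N)
  then show ?case using linear_compose[OF Suc linear_nbsum] by (simp only: funpow.simps)
qed

lemma nbsum_comp: "linear g \<Longrightarrow> nbsum (g \<circ> m) = g \<circ> nbsum m"
  by (auto simp: nbsum_def fun_eq_iff linear_add split: nat.split)

lemma nbsum_power_comp: "linear g \<Longrightarrow> (nbsum ^^ N) (g \<circ> m) = g \<circ> (nbsum ^^ N) m"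
  by (induction N) (simp_all add: nbsum_comp)

lemma linear_comp_fun: "linear g \<Longrightarrow> linear (\<lambda>m. g \<circ> (m :: nat \<Rightarrow> real^3))"
  by (rule linearI) (auto simp: fun_eq_iff scaleR_fun_def linear_add linear_scale)

lemma linear_hfield: "linear g \<Longrightarrow> linear (hfield g N)"
  using linear_compose[OF linear_comp_fun linear_nbsum_power, of g N]
  by (simp add: hfield_eq_nbsum[abs_def] o_def)

lemma hfield_hfield:
  assumes "linear g"
  shows "hfield g k (hfield h l m) = hfield (g \<circ> h) (k + l) m"
  by (simp add: hfield_eq_nbsum funpow_add nbsum_power_comp[OF assms] flip: comp_assoc)
    (simp add: comp_assoc nbsum_power_comp[OF assms])

lemma lie_bracket_hfield:
  assumes "linear g" "linear h"
  shows "lie_bracket (hfield g k) (hfield h l) = hfield (\<lambda>x. g (h x) - h (g x)) (k + l)"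
proof
  fix m :: "nat \<Rightarrow> real^3"
  have "((\<lambda>x. g (h x) - h (g x)) \<circ> m) = ((g \<circ> h) \<circ> m) - ((h \<circ> g) \<circ> m)"
    by (simp add: fun_eq_iff)
  then show "lie_bracket (hfield g k) (hfield h l) m
    = hfield (\<lambda>x. g (h x) - h (g x)) (k + l) m"
    by (simp add: lie_bracket_linear linear_hfield hfield_hfield assms add.commute[of l k])
      (simp add: hfield_eq_nbsum linear_diff[OF linear_nbsum_power])
qed

lemma hfield_uminus: "hfield (\<lambda>x. - g x) k = - hfield g k"
proof
  fix m :: "nat \<Rightarrow> real^3"
  have "(\<lambda>x. - g x) \<circ> m = - (g \<circ> m)" by (simp add: fun_eq_iff)
  then show "hfield (\<lambda>x. - g x) k m = (- hfield g k) m"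
    by (simp add: hfield_eq_nbsum linear_neg[OF linear_nbsum_power])
qed

lemma hfield_zero: "hfield (\<lambda>x. 0) k = 0"
  using hfield_uminus[of "\<lambda>x. 0" k] by (simp add: hfield_def fun_eq_iff)

lemma G0_eq_hfield: "G0 g = (1 / sqrt 2) *\<^sub>R hfield g 0"
  by (simp add: fun_eq_iff G0_def hfield_0 scaleR_fun_def)

lemma G1_eq_hfield: "G1 g = (1 / sqrt 2) *\<^sub>R hfield g 1"
  by (simp add: fun_eq_iff G1_def hfield_eq_nbsum nbsum_def scaleR_fun_def scaleR_add_right
      split: nat.split)

subsection \<open>Commutation relations\<close>

lemma linear_gstar: "linear gstar1" "linear gstar2" "linear gstar3"
  by (auto intro!: linearI simp: gstar1_def gstar2_def gstar3_def vec_eq_iff forall_3)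

lemma gstar_commutators:
  "gstar1 (gstar2 x) - gstar2 (gstar1 x) = - gstar3 x"
  "gstar2 (gstar3 x) - gstar3 (gstar2 x) = - gstar1 x"
  "gstar3 (gstar1 x) - gstar1 (gstar3 x) = - gstar2 x"
  "gstar2 (gstar1 x) - gstar1 (gstar2 x) = gstar3 x"
  "gstar3 (gstar2 x) - gstar2 (gstar3 x) = gstar1 x"
  "gstar1 (gstar3 x) - gstar3 (gstar1 x) = gstar2 x"
  by (auto simp: gstar1_def gstar2_def gstar3_def vec_eq_iff forall_3)

lemmas lie_bracket_hfield_gstar =
  linear_gstar[THEN lie_bracket_hfield, OF linear_gstar(1), unfolded gstar_commutators]
  linear_gstar[THEN lie_bracket_hfield, OF linear_gstar(2), unfolded gstar_commutators]
  linear_gstar[THEN lie_bracket_hfield, OF linear_gstar(3), unfolded gstar_commutators]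

theorem mainTheorem5:
  shows "Lie {G0 gstar1, G0 gstar2, G1 gstar1}
    = span (\<Union>k::nat. {hfield gstar1 k, hfield gstar2 k, hfield gstar3 k})"
    (is "Lie ?F = span ?S")
proof
  have lin: "linear f" if "f \<in> ?S" for f
    using that by (auto intro: linear_hfield linear_gstar)
  have gen: "?F \<subseteq> span ?S"
    unfolding G0_eq_hfield G1_eq_hfield
    by (intro insert_subsetI empty_subsetI span_scale span_base) auto
  have closed: "lie_bracket f g \<in> span ?S" if "f \<in> ?S" "g \<in> ?S" for f g
  proof -
    have "hfield gstar1 k \<in> span ?S" "hfield gstar2 k \<in> span ?S" "hfield gstar3 k \<in> span ?S" for k
      by (auto intro!: span_base)
    then show ?thesis
      using that by (auto simp only: lie_bracket_hfield_gstar hfield_uminus hfield_zero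
          span_zero span_neg diff_self)
  qed
  show "Lie ?F \<subseteq> span ?S"
    by (rule Lie_subset_span[OF lin gen closed])
next
  have linF: "linear f" if "f \<in> ?F" for f
    using that
    by (auto simp: G0_eq_hfield G1_eq_hfield intro!: linear_fun_scaleR linear_hfield linear_gstar)
  have br: "lie_bracket f g \<in> Lie ?F" if "f \<in> Lie ?F" "g \<in> Lie ?F" for f g
    by (rule lie_bracket_in_Lie[OF linF that])
  have unscale: "f \<in> Lie ?F" if "(1 / sqrt 2) *\<^sub>R f \<in> ?F" for f
  proof -
    have "sqrt 2 *\<^sub>R (1 / sqrt 2) *\<^sub>R f \<in> Lie ?F"
      unfolding Lie_def by (intro span_scale span_base iterated_brackets.generator that)
    then show ?thesis by simp
  qed
  have h10: "hfield gstar1 0 \<in> Lie ?F" and h20: "hfield gstar2 0 \<in> Lie ?F"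
    and h11: "hfield gstar1 1 \<in> Lie ?F"
    by (rule unscale, simp add: G0_eq_hfield G1_eq_hfield)+
  have h30: "hfield gstar3 0 \<in> Lie ?F"
    using br[OF h20 h10] by (simp add: lie_bracket_hfield_gstar)
  have h31: "hfield gstar3 1 \<in> Lie ?F"
    using br[OF h20 h11] by (simp add: lie_bracket_hfield_gstar)
  have all: "hfield gstar1 k \<in> Lie ?F \<and> hfield gstar2 k \<in> Lie ?F \<and> hfield gstar3 k \<in> Lie ?F" for k
  proof (induction k)
    case 0
    show ?case using h10 h20 h30 by simp
  next
    case (Suc k)
    have h1: "hfield gstar1 (Suc k) \<in> Lie ?F"
      using br[OF h31, of "hfield gstar2 k"] Suc by (simp add: lie_bracket_hfield_gstar)
    have "hfield gstar2 (Suc k) \<in> Lie ?F"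
      using br[OF h1 h30] by (simp add: lie_bracket_hfield_gstar)
    moreover have "hfield gstar3 (Suc k) \<in> Lie ?F"
      using br[OF h20 h1] by (simp add: lie_bracket_hfield_gstar)
    ultimately show ?case using h1 by blast
  qed
  then have "?S \<subseteq> Lie ?F" by auto
  then show "span ?S \<subseteq> Lie ?F"
    unfolding Lie_def by (intro span_minimal subspace_span)
qed

end
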